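(* $\mathrm{PWPP}(n,n-1)$ polynomial-time reduces to \textsc{Unary Long Choice}.
   Context: All circuits are Boolean circuits of size polynomial in $n$. A search problem $A$ polynomial-time reduces to a search problem $B$ if there are polynomial-time computable maps $f,g$ such that for every instance $I$ of $A$, $f(I)$ is an instance of $B$, and for every solution $s$ of $f(I)$, $g(I,s)$ is a solution of $I$. $\mathrm{PWPP}(n,m)$ (for $m<n$): given a poly($n$)-size circuit $C:\{0,1\}^n\to\{0,1\}^m$, find $x\neq y$ with $C(x)=C(y)$. \textsc{Unary Long Choice}: Let $U=\{0,1\}^n$. The input is a sequence of predicates $P_0,\dots,P_{n-2}$ given by poly($n$)-size circuits, where $P_i:U^{i+2}\to\{0,1\}$ and the value $P_i(a_0,\dots,a_i,x)$ depends only on the last argument $x$ (equivalently, each $P_i$ is given as a circuit $U\to\{0,1\}$ applied to the last argument). A solution is a sequence of $n+1$ distinct elements $a_0,\dots,a_n\in U$ such that for every $i\in\{0,\dots,n-2\}$, $P_i(a_0,\dots,a_i,a_j)$ is the same for all $j>i$. *)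

theory Defs
  imports Main
begin

datatype move = MoveL | MoveR | Stay

text \<open>Tape symbols are natural numbers below tm_nsyms; 0 is the blank, 1 encodes the bit
False and 2 encodes the bit True. States are natural numbers below tm_nstates; 0 is the
start state and 1 is the (unique, absorbing) halting state.\<close>

record tm =
  tm_nstates :: nat
  tm_nsyms :: nat
  tm_delta :: "nat \<Rightarrow> nat \<Rightarrow> nat \<times> nat \<times> move"

definition tm_wf :: "tm \<Rightarrow> bool" where
  "tm_wf M \<longleftrightarrow> 2 \<le> tm_nstates M \<and> 3 \<le> tm_nsyms M \<and>
     (\<forall>q s. q < tm_nstates M \<and> s < tm_nsyms M \<longrightarrow>
        (case tm_delta M q s of (q', s', m) \<Rightarrow> q' < tm_nstates M \<and> s' < tm_nsyms M))"

text \<open>Configuration: (state, cells left of the head in reverse order, head cell and the cells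
to its right). Cells beyond the stored lists are blank.\<close>
type_synonym config = "nat \<times> nat list \<times> nat list"

definition head_sym :: "nat list \<Rightarrow> nat" where
  "head_sym rs = (case rs of [] \<Rightarrow> 0 | s # _ \<Rightarrow> s)"

definition tm_step :: "tm \<Rightarrow> config \<Rightarrow> config" where
  "tm_step M c = (case c of (q, ls, rs) \<Rightarrow>
     if q = 1 then c else
     (case tm_delta M q (head_sym rs) of (q', s', m) \<Rightarrow>
       let rs' = s' # drop 1 rs in
       (case m of
          Stay \<Rightarrow> (q', ls, rs')
        | MoveR \<Rightarrow> (q', s' # ls, drop 1 rs)
        | MoveL \<Rightarrow> (case ls of [] \<Rightarrow> (q', [], rs') | l # ls' \<Rightarrow> (q', ls', l # rs')))))"

definition bit_sym :: "bool \<Rightarrow> nat" where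
  "bit_sym b = (if b then 2 else 1)"

definition tm_init :: "bool list \<Rightarrow> config" where
  "tm_init x = (0, [], map bit_sym x)"

definition tm_output :: "config \<Rightarrow> bool list" where
  "tm_output c = (case c of (q, ls, rs) \<Rightarrow> map (\<lambda>s. s = 2) (takeWhile (\<lambda>s. s = 1 \<or> s = 2) rs))"

definition poly_time_computable :: "(bool list \<Rightarrow> bool list) \<Rightarrow> bool" where
  "poly_time_computable F \<longleftrightarrow>
     (\<exists>M c k. tm_wf M \<and>
        (\<forall>x. \<exists>t. t \<le> c * (length x + 1) ^ k \<and>
              fst ((tm_step M ^^ t) (tm_init x)) = 1 \<and>
              tm_output ((tm_step M ^^ t) (tm_init x)) = F x))"

text \<open>Straight-line circuits: wires 0..n-1 are the inputs, wire n+k is the output of gate k.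
A reference to a wire that does not (yet) exist reads as the constant False.\<close>
datatype gate = GAnd nat nat | GOr nat nat | GNot nat

datatype circuit = Circuit (c_nin: nat) (c_gates: "gate list") (c_outs: "nat list")

definition wire :: "bool list \<Rightarrow> nat \<Rightarrow> bool" where
  "wire vs i = (if i < length vs then vs ! i else False)"

fun gate_val :: "bool list \<Rightarrow> gate \<Rightarrow> bool" where
  "gate_val vs (GAnd i j) = (wire vs i \<and> wire vs j)"
| "gate_val vs (GOr i j) = (wire vs i \<or> wire vs j)"
| "gate_val vs (GNot i) = (\<not> wire vs i)"

definition eval_circuit :: "circuit \<Rightarrow> bool list \<Rightarrow> bool list" where
  "eval_circuit C x =
     (let vs = foldl (\<lambda>vs g. vs @ [gate_val vs g]) x (c_gates C) in map (wire vs) (c_outs C))"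

definition bits_code :: "bool list \<Rightarrow> bool list" where
  "bits_code w = concat (map (\<lambda>b. [True, b]) w) @ [False]"

definition code :: "bool list list \<Rightarrow> bool list" where
  "code ws = concat (map bits_code ws)"

definition unary :: "nat \<Rightarrow> bool list" where
  "unary n = replicate n True"

fun gate_words :: "gate \<Rightarrow> bool list list" where
  "gate_words (GAnd i j) = [[False, False], unary i, unary j]"
| "gate_words (GOr i j) = [[False, True], unary i, unary j]"
| "gate_words (GNot i) = [[True], unary i, []]"

definition enc_circuit :: "circuit \<Rightarrow> bool list" where
  "enc_circuit C = code ([unary (c_nin C), unary (length (c_gates C))]
      @ concat (map gate_words (c_gates C))
      @ [unary (length (c_outs C))] @ map unary (c_outs C))"

definition pwpp_instance :: "circuit \<Rightarrow> bool" where
  "pwpp_instance C \<longleftrightarrow> 1 \<le> c_nin C \<and> length (c_outs C) = c_nin C - 1"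

definition pwpp_solution :: "circuit \<Rightarrow> bool list \<Rightarrow> bool list \<Rightarrow> bool" where
  "pwpp_solution C x y \<longleftrightarrow> length x = c_nin C \<and> length y = c_nin C \<and> x \<noteq> y \<and>
     eval_circuit C x = eval_circuit C y"

text \<open>An instance is the number n together with circuits P_0, ..., P_(n-2), each from
{0,1}^n to {0,1} (the predicate P_i applied to its last argument).\<close>
definition ulc_instance :: "nat \<Rightarrow> circuit list \<Rightarrow> bool" where
  "ulc_instance n Ps \<longleftrightarrow> length Ps = n - 1 \<and>
     (\<forall>P \<in> set Ps. c_nin P = n \<and> length (c_outs P) = 1)"

definition ulc_pred :: "circuit \<Rightarrow> bool list \<Rightarrow> bool" where
  "ulc_pred P x = hd (eval_circuit P x)"

definition ulc_solution :: "nat \<Rightarrow> circuit list \<Rightarrow> bool list list \<Rightarrow> bool" where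
  "ulc_solution n Ps as \<longleftrightarrow> length as = n + 1 \<and> distinct as \<and>
     (\<forall>a \<in> set as. length a = n) \<and>
     (\<forall>i. i + 2 \<le> n \<longrightarrow>
        (\<forall>j k. i < j \<and> j \<le> n \<and> i < k \<and> k \<le> n \<longrightarrow>
           ulc_pred (Ps ! i) (as ! j) = ulc_pred (Ps ! i) (as ! k)))"

definition enc_ulc :: "nat \<Rightarrow> circuit list \<Rightarrow> bool list" where
  "enc_ulc n Ps = code (unary n # map enc_circuit Ps)"

end

theory Submission
  imports Defs
begin

text \<open>Take \<open>P\<^sub>i\<close> to be the \<open>i\<close>-th output bit of \<open>C\<close>. In a solution \<open>a\<^sub>0, \<dots>, a\<^sub>n\<close> every \<open>P\<^sub>i\<close> is
constant on \<open>a\<^sub>j\<close> for \<open>j > i\<close>, so \<open>C\<close> takes the same value on the distinct elements \<open>a\<^bsub>n-1\<^esub>\<close> and \<open>a\<^sub>n\<close>.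

Both translations are carried out by two-way machines that append to a separate output; these are
simulated on a single tape that keeps the output to the right of the input. A rank that decreases in
every step bounds the running time on all inputs, malformed ones included, so that the computed
function has to be determined only on encodings.\<close>

section \<open>Turing machines over a finite set of structured states\<close>

text \<open>The dimensions fit exactly: C has n-1 output bits, one for each predicate index 0 to
  n-2, and n-1 and n are the two positions beyond all these indices. The rest of the work comes from
  the machine model, which reads the result from the head position onwards and asks for a polynomial
  bound on every bit list. The encoding of C is read again for every output bit while the result
  grows, so the result must not overwrite it. Every simulated step makes a trip to the end of the
  output, which is where the square in the final time bound comes from. Neither machine parses
  gates: the encoding of a predicate differs from that of C only in its final output list, and the
  answer \<open>code [x, y]\<close> is a suffix of \<open>code as\<close>, which can be copied
  without decoding the words.\<close>

datatype cell = LeftEnd | RightEnd | Plain bool | Marked bool | Cut | Used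

text \<open>\<open>Tagged\<close> marks the cell that the head has left for a trip to the output, so
  that it can be found again.\<close>

datatype sym = Blank | Bit bool | Cell cell | Tagged cell

fun cell_num :: "cell \<Rightarrow> nat" where
  "cell_num LeftEnd = 0"
| "cell_num RightEnd = 1"
| "cell_num (Plain b) = (if b then 2 else 3)"
| "cell_num (Marked b) = (if b then 4 else 5)"
| "cell_num Cut = 6"
| "cell_num Used = 7"

text \<open>The numbers 0, 1, 2 are dictated by \<open>tm_init\<close> and \<open>tm_output\<close>.
  The eight cells follow from 3 on and their tagged copies from 11 on, 19 symbols
  altogether.\<close>

fun sym_num :: "sym \<Rightarrow> nat" where
  "sym_num Blank = 0"
| "sym_num (Bit b) = bit_sym b"
| "sym_num (Cell c) = 3 + cell_num c"
| "sym_num (Tagged c) = 11 + cell_num c"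

lemma cell_num_less: "cell_num c < 8"
  by (cases c) auto

lemma inj_cell_num: "inj cell_num"
proof (rule injI)
  fix c d assume "cell_num c = cell_num d"
  then show "c = d" by (cases c; cases d) (auto split: if_splits)
qed

lemma sym_num_less: "sym_num s < 19"
proof (cases s)
  case (Cell c)
  then show ?thesis using cell_num_less[of c] by simp
next
  case (Tagged c)
  then show ?thesis using cell_num_less[of c] by simp
qed (simp_all add: bit_sym_def)

lemma inj_sym_num: "inj sym_num"
proof (rule injI)
  fix s t assume "sym_num s = sym_num t"
  then show "s = t"
    using cell_num_less[of "case s of Cell c \<Rightarrow> c | _ \<Rightarrow> Cut"]
      cell_num_less[of "case t of Cell c \<Rightarrow> c | _ \<Rightarrow> Cut"]
    by (cases s; cases t) (auto simp: bit_sym_def dest: injD[OF inj_cell_num] split: if_splits)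
qed

type_synonym 's sconfig = "'s \<times> sym list \<times> sym list"

definition scanned :: "sym list \<Rightarrow> sym" where
  "scanned rs = (case rs of [] \<Rightarrow> Blank | s # _ \<Rightarrow> s)"

lemma scanned_simps [simp]: "scanned [] = Blank" "scanned (s # rs) = s"
  by (simp_all add: scanned_def)

definition sstep :: "('s \<Rightarrow> sym \<Rightarrow> 's \<times> sym \<times> move) \<Rightarrow> 's \<Rightarrow> 's sconfig \<Rightarrow> 's sconfig" where
  "sstep d stop c = (case c of (q, ls, rs) \<Rightarrow>
     if q = stop then c else
     (case d q (scanned rs) of (q', s', m) \<Rightarrow>
       (case m of
          Stay \<Rightarrow> (q', ls, s' # drop 1 rs)
        | MoveR \<Rightarrow> (q', s' # ls, drop 1 rs)
        | MoveL \<Rightarrow> (case ls of [] \<Rightarrow> (q', [], s' # drop 1 rs)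
                    | l # ls' \<Rightarrow> (q', ls', l # s' # drop 1 rs)))))"

definition sconfig_num :: "('s \<Rightarrow> nat) \<Rightarrow> 's sconfig \<Rightarrow> config" where
  "sconfig_num f c = (case c of (q, ls, rs) \<Rightarrow> (f q, map sym_num ls, map sym_num rs))"

text \<open>The machine model fixes the numbers 0 and 1 for the start and halting states; the
  remaining states are numbered from 2 by any bijection. The simulation is step by step, so time
  bounds carry over unchanged.\<close>

lemma tm_of_finite_states:
  fixes d :: "'s \<Rightarrow> sym \<Rightarrow> 's \<times> sym \<times> move"
  assumes fin: "finite Q" and start: "start \<in> Q" and stop: "stop \<in> Q" and neq: "start \<noteq> stop"
    and closed: "\<And>q s. q \<in> Q \<Longrightarrow> fst (d q s) \<in> Q"
  obtains M f where "tm_wf M" "f start = 0" "f stop = 1"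
    "\<And>t c. fst c \<in> Q \<Longrightarrow>
       (tm_step M ^^ t) (sconfig_num f c) = sconfig_num f ((sstep d stop ^^ t) c)"
proof -
  obtain g :: "'s \<Rightarrow> nat" where g: "bij_betw g (Q - {start, stop}) {0..<card (Q - {start, stop})}"
    using ex_bij_betw_finite_nat[of "Q - {start, stop}"] fin by auto
  define f where "f q = (if q = start then 0 else if q = stop then 1 else g q + 2)" for q
  define N where "N = card (Q - {start, stop}) + 2"
  have f_less: "f q < N" if "q \<in> Q" for q
    using that bij_betwE[OF g] by (auto simp: f_def N_def)
  have f_inj: "inj_on f Q"
  proof (rule inj_onI)
    fix p q assume "p \<in> Q" "q \<in> Q" "f p = f q"
    then show "p = q"
      using inj_onD[OF bij_betw_imp_inj_on[OF g], of p q]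
      by (cases "p = start"; cases "p = stop"; cases "q = start"; cases "q = stop") (simp_all add: f_def)
  qed
  \<comment> \<open>Arguments that encode no state or symbol get a fixed legal transition, so that
    \<open>tm_wf\<close> follows without showing that the numberings are onto.\<close>
  define dd where "dd n k =
    (if n \<in> f ` Q \<and> k \<in> range sym_num
     then (case d (inv_into Q f n) (inv sym_num k) of (q, s, m) \<Rightarrow> (f q, sym_num s, m))
     else (0, 0, Stay))" for n k
  define M where "M = \<lparr>tm_nstates = N, tm_nsyms = 19, tm_delta = dd\<rparr>"
  have dd: "dd (f q) (sym_num s) = (case d q s of (q, s, m) \<Rightarrow> (f q, sym_num s, m))"
    if "q \<in> Q" for q s
    unfolding dd_def inv_into_f_f[OF f_inj that] inv_f_f[OF inj_sym_num] using that by simp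
  have wf: "tm_wf M"
    unfolding tm_wf_def
  proof (intro conjI allI impI)
    fix n k
    show "case tm_delta M n k of (q', s', m) \<Rightarrow> q' < tm_nstates M \<and> s' < tm_nsyms M"
    proof (cases "n \<in> f ` Q \<and> k \<in> range sym_num")
      case True
      then obtain q s where "q \<in> Q" "n = f q" "k = sym_num s" by auto
      then show ?thesis
        using closed[of q s] sym_num_less f_less dd[of q s] by (cases "d q s") (simp add: M_def)
    next
      case False
      then have "dd n k = (0, 0, Stay)" unfolding dd_def by (rule if_not_P)
      then show ?thesis by (simp add: M_def N_def)
    qed
  qed (auto simp: M_def N_def)
  have head: "head_sym (map sym_num rs) = sym_num (scanned rs)" for rs
    by (cases rs) (auto simp: head_sym_def)
  have one: "f q = Suc 0 \<longleftrightarrow> q = stop" for q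
    using neq by (auto simp: f_def)
  have step: "tm_step M (sconfig_num f c) = sconfig_num f (sstep d stop c)" if "fst c \<in> Q" for c
  proof -
    obtain q ls rs where c: "c = (q, ls, rs)" by (cases c)
    obtain q' s' m where d: "d q (scanned rs) = (q', s', m)" by (cases "d q (scanned rs)")
    have "dd (f q) (sym_num (scanned rs)) = (f q', sym_num s', m)"
      using that c d dd by auto
    then show ?thesis
      using d unfolding c tm_step_def sconfig_num_def sstep_def
      by (cases ls; cases m) (simp_all add: head one M_def Let_def drop_map)
  qed
  have closed_step: "fst (sstep d stop c) \<in> Q" if "fst c \<in> Q" for c
    using that closed[of "fst c" "scanned (snd (snd c))"]
    by (auto simp: sstep_def split: prod.splits move.splits list.splits)
  have "(tm_step M ^^ t) (sconfig_num f c) = sconfig_num f ((sstep d stop ^^ t) c) \<and>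
      fst ((sstep d stop ^^ t) c) \<in> Q" if "fst c \<in> Q" for t c
    by (induction t) (use that step closed_step in auto)
  moreover have "f start = 0" "f stop = 1" using neq by (auto simp: f_def)
  ultimately show thesis using that wf by blast
qed

section \<open>Two-way machines with append-only output\<close>

datatype 'q action = Halt | GoL 'q cell "bool list" | GoR 'q cell "bool list"

type_synonym 'q oconfig = "'q \<times> cell list \<times> cell list \<times> bool list"

text \<open>Neither rule applies at an edge: the tape never grows, and a move that would leave it is
  impossible.\<close>

inductive ostep :: "('q \<Rightarrow> cell \<Rightarrow> 'q action) \<Rightarrow> 'q oconfig \<Rightarrow> 'q oconfig \<Rightarrow> bool"
  for act where
  right: "act q c = GoR q' s bs \<Longrightarrow> rs \<noteq> [] \<Longrightarrow>
     ostep act (q, ls, c # rs, out) (q', s # ls, rs, out @ bs)"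
| left: "act q c = GoL q' s bs \<Longrightarrow>
     ostep act (q, l # ls, c # rs, out) (q', ls, l # s # rs, out @ bs)"

inductive yields :: "('q \<Rightarrow> cell \<Rightarrow> 'q action) \<Rightarrow> 'q oconfig \<Rightarrow> bool list \<Rightarrow> bool"
  for act where
  halt: "act q c = Halt \<Longrightarrow> yields act (q, ls, c # rs, out) out"
| step: "ostep act a b \<Longrightarrow> yields act b out \<Longrightarrow> yields act a out"

lemmas yields_right = yields.step[OF ostep.right]
lemmas yields_left = yields.step[OF ostep.left]

lemma ostep_deterministic: "ostep act a b \<Longrightarrow> ostep act a c \<Longrightarrow> b = c"
  by (elim ostep.cases) auto

lemma yields_unique: "yields act a out \<Longrightarrow> yields act a out' \<Longrightarrow> out = out'"
proof (induction rule: yields.induct)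
  case (halt q c ls rs out)
  from halt(2,1) show ?case
    by (cases rule: yields.cases) (auto elim: ostep.cases)
next
  case (step a b out)
  from step.prems show ?case
  proof (cases rule: yields.cases)
    case (halt q c ls rs)
    then show ?thesis using step.hyps(1) by (auto elim: ostep.cases)
  next
    case (step b')
    then show ?thesis
      using step.IH ostep_deterministic[OF step.hyps(1)] by blast
  qed
qed

text \<open>This rule and the next two reason backwards: what the later configuration yields, the
  earlier one yields too. Proofs about concrete machines therefore list the configurations of a run
  from the last to the first.\<close>

lemma yields_pass_right:
  assumes "\<And>c. c \<in> set xs \<Longrightarrow> act q c = GoR q (g c) (h c)" "ys \<noteq> []"
    "yields act (q, rev (map g xs) @ ls, ys, out @ concat (map h xs)) res"
  shows "yields act (q, ls, xs @ ys, out) res"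
  using assms
proof (induction xs arbitrary: ls out)
  case (Cons x xs)
  have "yields act (q, g x # ls, xs @ ys, out @ h x) res"
    using Cons.prems by (intro Cons.IH) auto
  then show ?case using Cons.prems(1)[of x] assms(2) by (auto intro: yields_right)
qed simp

lemma yields_scan_right:
  assumes "\<And>c. c \<in> set xs \<Longrightarrow> act q c = GoR q c []" "ys \<noteq> []"
    "yields act (q, rev xs @ ls, ys, out) res"
  shows "yields act (q, ls, xs @ ys, out) res"
proof -
  have nil: "concat (map (\<lambda>_. [] :: bool list) xs) = []" by simp
  show ?thesis
    by (rule yields_pass_right[where act = act and g = id and h = "\<lambda>_. []"], unfold nil)
      (use assms in simp_all)
qed

text \<open>Combines the step that turns left, writing \<open>s\<close> in state \<open>q\<close>,
  with the sweep in \<open>q'\<close> that follows. \<open>ys\<close> is listed from the head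
  outwards, hence reversed once it lies to the right of \<open>m\<close>.\<close>

lemma yields_go_left:
  assumes "act q c = GoL q' s bs" "\<And>y. y \<in> set ys \<Longrightarrow> act q' y = GoL q' y []"
    "yields act (q', ls, m # rev ys @ s # rs, out @ bs) res"
  shows "yields act (q, ys @ m # ls, c # rs, out) res"
  using assms
proof (induction ys arbitrary: q c s bs rs out)
  case Nil
  then show ?case using yields_left[where act = act, OF Nil.prems(1)] by simp
next
  case (Cons y ys)
  have "yields act (q', ys @ m # ls, y # s # rs, out @ bs) res"
    using Cons.prems by (intro Cons.IH[where bs = "[]" and s = y]) auto
  then show ?case using yields_left[where act = act, OF Cons.prems(1)] by simp
qed

section \<open>Simulation of output machines on a single tape\<close>

definition initial :: "'q \<Rightarrow> bool list \<Rightarrow> 'q oconfig" where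
  "initial q x = (q, [], LeftEnd # map Plain x @ [RightEnd], [])"

text \<open>The input starts in the leftmost cell, so \<open>LeftEnd\<close> needs room:
  \<open>Shift\<close> carries the bit displaced by shifting the input one cell to the right.
  \<open>Append\<close> holds the bits still to be written and, like \<open>Return\<close>, whether
  the simulated move goes right.\<close>

datatype 'q sim_state = Begin | Stop | Shift bool | Close | Rewind | Finish
  | Main 'q | Append 'q bool "bool list" | Return 'q bool

fun sim_delta :: "('q \<Rightarrow> cell \<Rightarrow> 'q action) \<Rightarrow> 'q \<Rightarrow>
    'q sim_state \<Rightarrow> sym \<Rightarrow> 'q sim_state \<times> sym \<times> move" where
  "sim_delta act q0 Begin (Bit b) = (Shift b, Cell LeftEnd, MoveR)"
| "sim_delta act q0 Begin s = (Close, Cell LeftEnd, MoveR)"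
| "sim_delta act q0 (Shift b) (Bit b') = (Shift b', Cell (Plain b), MoveR)"
| "sim_delta act q0 (Shift b) s = (Close, Cell (Plain b), MoveR)"
| "sim_delta act q0 Close s = (Rewind, Cell RightEnd, Stay)"
| "sim_delta act q0 Rewind s = (if s = Cell LeftEnd then (Main q0, s, Stay) else (Rewind, s, MoveL))"
| "sim_delta act q0 (Main q) (Cell c) =
     (case act q c of
        Halt \<Rightarrow> (Finish, Cell c, Stay)
      | GoL q' c' bs \<Rightarrow> (Append q' False bs, Tagged c', MoveR)
      | GoR q' c' bs \<Rightarrow> (Append q' True bs, Tagged c', MoveR))"
| "sim_delta act q0 (Main q) s = (Stop, s, Stay)"
| "sim_delta act q0 (Append q r []) Blank = (Return q r, Blank, Stay)"
| "sim_delta act q0 (Append q r (b # bs)) Blank = (Append q r bs, Bit b, MoveR)"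
| "sim_delta act q0 (Append q r bs) s = (Append q r bs, s, MoveR)"
| "sim_delta act q0 (Return q r) (Tagged c) = (Main q, Cell c, if r then MoveR else MoveL)"
| "sim_delta act q0 (Return q r) s = (Return q r, s, MoveL)"
| "sim_delta act q0 Finish s = (if s = Cell RightEnd then (Stop, s, MoveR) else (Finish, s, MoveR))"
| "sim_delta act q0 Stop s = (Stop, s, Stay)"

text \<open>The lists in \<open>Append\<close> make the type infinite; bounding them by the longest
  output of one step leaves finitely many states.\<close>

definition sim_states :: "nat \<Rightarrow> 'q sim_state set" where
  "sim_states B = {Begin, Stop, Close, Rewind, Finish} \<union> range Shift \<union> range Main
     \<union> (\<lambda>(q, r, bs). Append q r bs) ` (UNIV \<times> UNIV \<times> {bs. set bs \<subseteq> UNIV \<and> length bs \<le> B})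
     \<union> (\<lambda>(q, r). Return q r) ` UNIV"

lemma mem_sim_states [simp]:
  "Begin \<in> sim_states B" "Stop \<in> sim_states B" "Close \<in> sim_states B" "Rewind \<in> sim_states B"
  "Finish \<in> sim_states B" "Shift b \<in> sim_states B" "Main q \<in> sim_states B"
  "Return q r \<in> sim_states B"
  by (auto simp: sim_states_def)

lemma Append_mem_sim_states [simp]: "Append q r bs \<in> sim_states B \<longleftrightarrow> length bs \<le> B"
proof -
  have "length bs \<le> B \<Longrightarrow> Append q r bs \<in> (\<lambda>(q, r, bs). Append q r bs) `
      (UNIV \<times> UNIV \<times> {bs. set bs \<subseteq> UNIV \<and> length bs \<le> B})"
    by (rule image_eqI[of _ _ "(q, r, bs)"]) auto
  then show ?thesis by (auto simp: sim_states_def)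
qed

lemma finite_sim_states: "finite (sim_states B :: 'q::finite sim_state set)"
  unfolding sim_states_def
  by (intro finite_UnI finite_imageI finite_cartesian_product finite_lists_length_le finite) auto

text \<open>The end conditions are local: a step neither creates nor erases an end marker and never
  moves past one. The rank has to fall on arbitrary tapes, so it bounds the length of every
  run.\<close>

locale output_machine =
  fixes act :: "'q::finite \<Rightarrow> cell \<Rightarrow> 'q action" and q0 :: 'q and B :: nat
    and rank :: "'q \<Rightarrow> cell list \<Rightarrow> cell list \<Rightarrow> nat"
  assumes right_ends: "act q c = GoR q' s bs \<Longrightarrow>
      c \<noteq> RightEnd \<and> s \<noteq> RightEnd \<and> (s = LeftEnd \<longleftrightarrow> c = LeftEnd)"
    and left_ends: "act q c = GoL q' s bs \<Longrightarrow>
      c \<noteq> LeftEnd \<and> s \<noteq> LeftEnd \<and> (s = RightEnd \<longleftrightarrow> c = RightEnd)"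
    and right_length: "act q c = GoR q' s bs \<Longrightarrow> length bs \<le> B"
    and left_length: "act q c = GoL q' s bs \<Longrightarrow> length bs \<le> B"
    and right_rank: "act q c = GoR q' s bs \<Longrightarrow> rank q' (s # ls) rs < rank q ls (c # rs)"
    and left_rank: "act q c = GoL q' s bs \<Longrightarrow> rank q' ls (l # s # rs) < rank q (l # ls) (c # rs)"
begin

abbreviation sstep' :: "'q sim_state sconfig \<Rightarrow> 'q sim_state sconfig" where
  "sstep' \<equiv> sstep (sim_delta act q0) Stop"

definition within :: "nat \<Rightarrow> 'q sim_state sconfig \<Rightarrow> 'q sim_state sconfig \<Rightarrow> bool" where
  "within n a b \<longleftrightarrow> (\<exists>t\<le>n. (sstep' ^^ t) a = b)"

lemma within_trans [trans]: "within m a b \<Longrightarrow> within n b c \<Longrightarrow> within (m + n) a c"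
  unfolding within_def
proof (elim exE conjE)
  fix s t assume "s \<le> m" "(sstep' ^^ s) a = b" "t \<le> n" "(sstep' ^^ t) b = c"
  then show "\<exists>u\<le>m + n. (sstep' ^^ u) a = c"
    by (intro exI[of _ "t + s"]) (simp add: funpow_add)
qed

lemma within_mono: "within m a b \<Longrightarrow> m \<le> n \<Longrightarrow> within n a b"
  unfolding within_def using order_trans by blast

lemma within_refl: "within 0 a a"
  by (simp add: within_def)

lemma within_step: "sstep' a = b \<Longrightarrow> within 1 a b"
  unfolding within_def by (intro exI[of _ 1]) simp

lemma sim_scan_right:
  assumes "\<And>s. s \<in> set xs \<Longrightarrow> sim_delta act q0 q s = (q, s, MoveR)" "q \<noteq> Stop"
  shows "within (length xs) (q, ls, xs @ rs) (q, rev xs @ ls, rs)"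
  using assms(1)
proof (induction xs arbitrary: ls)
  case Nil
  then show ?case by (simp add: within_refl)
next
  case (Cons x xs)
  have "within 1 (q, ls, (x # xs) @ rs) (q, x # ls, xs @ rs)"
    using Cons.prems[of x] assms(2) by (intro within_step) (simp add: sstep_def)
  from within_trans[OF this Cons.IH] show ?case using Cons.prems by simp
qed

lemma sim_scan_left:
  assumes "\<And>s. s \<in> set (x # xs) \<Longrightarrow> sim_delta act q0 q s = (q, s, MoveL)" "q \<noteq> Stop"
  shows "within (length xs + 1) (q, xs @ l # ls, x # rs) (q, ls, l # rev xs @ x # rs)"
  using assms(1)
proof (induction xs arbitrary: x rs)
  case Nil
  then show ?case using assms(2) by (auto intro!: within_step[simplified] simp: sstep_def)
next
  case (Cons y xs)
  have "within 1 (q, (y # xs) @ l # ls, x # rs) (q, xs @ l # ls, y # x # rs)"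
    using Cons.prems[of x] assms(2) by (intro within_step) (simp add: sstep_def)
  from within_trans[OF this Cons.IH] show ?case using Cons.prems by simp
qed

lemma sim_shift:
  "within (length x + 1) (Shift b, ls, map Bit x)
     (Close, rev (map (Cell \<circ> Plain) (b # x)) @ ls, [])"
proof (induction x arbitrary: b ls)
  case Nil
  then show ?case by (auto intro!: within_step[simplified] simp: sstep_def)
next
  case (Cons a x)
  have "within 1 (Shift b, ls, map Bit (a # x)) (Shift a, Cell (Plain b) # ls, map Bit x)"
    by (intro within_step) (simp add: sstep_def)
  from within_trans[OF this Cons.IH] show ?case by simp
qed

text \<open>Shifting the input takes \<open>length x + 1\<close> steps, writing
  \<open>RightEnd\<close> one, the way back \<open>length x + 1\<close>, and entering
  \<open>Main\<close> one.\<close>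

lemma sim_setup:
  "within (2 * length x + 4) (Begin, [], map Bit x)
     (Main q0, [], map Cell (LeftEnd # map Plain x @ [RightEnd]))"
proof -
  have "within (length x + 1) (Begin, [], map Bit x)
      (Close, rev (map (Cell \<circ> Plain) x) @ [Cell LeftEnd], [])"
  proof (cases x)
    case Nil
    then show ?thesis by (auto intro!: within_step[simplified] simp: sstep_def)
  next
    case (Cons b y)
    have "within 1 (Begin, [], map Bit x) (Shift b, [Cell LeftEnd], map Bit y)"
      unfolding Cons by (intro within_step) (simp add: sstep_def)
    from within_trans[OF this sim_shift] show ?thesis unfolding Cons by simp
  qed
  also have "within 1 (Close, rev (map (Cell \<circ> Plain) x) @ [Cell LeftEnd], [])
      (Rewind, rev (map (Cell \<circ> Plain) x) @ [Cell LeftEnd], [Cell RightEnd])"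
    by (intro within_step) (simp add: sstep_def)
  also have "within (length (rev (map (Cell \<circ> Plain) x)) + 1)
      (Rewind, rev (map (Cell \<circ> Plain) x) @ [Cell LeftEnd], [Cell RightEnd])
      (Rewind, [], Cell LeftEnd # rev (rev (map (Cell \<circ> Plain) x)) @ [Cell RightEnd])"
    by (rule sim_scan_left) auto
  also have "within 1 (Rewind, [], Cell LeftEnd # rev (rev (map (Cell \<circ> Plain) x)) @ [Cell RightEnd])
      (Main q0, [], map Cell (LeftEnd # map Plain x @ [RightEnd]))"
    by (intro within_step) (simp add: sstep_def)
  finally have "within (length x + 1 + 1 + (length (rev (map (Cell \<circ> Plain) x)) + 1) + 1)
      (Begin, [], map Bit x) (Main q0, [], map Cell (LeftEnd # map Plain x @ [RightEnd]))" .
  from within_mono[OF this, of "2 * length x + 4"] show ?thesis by simp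
qed

lemma sim_append:
  assumes "z = [] \<or> z = [Blank]"
  shows "within (length bs + 1) (Append q r bs, ls, z) (Return q r, rev (map Bit bs) @ ls, [Blank])"
  using assms
proof (induction bs arbitrary: ls z)
  case Nil
  then show ?case by (auto intro!: within_step[simplified] simp: sstep_def)
next
  case (Cons b bs)
  have "within 1 (Append q r (b # bs), ls, z) (Append q r bs, Bit b # ls, [])"
    using Cons.prems by (intro within_step) (auto simp: sstep_def)
  from within_trans[OF this Cons.IH] show ?case by simp
qed

text \<open>The list \<open>z\<close> of trailing blanks is needed because the first excursion to the end of the
output leaves an explicit blank cell behind.\<close>

lemma sim_excursion:
  assumes "z = [] \<or> z = [Blank]" "m = (if r then MoveR else MoveL)"
    "sim_delta act q0 (Main q) (Cell c) = (Append q' r bs, Tagged s, MoveR)"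
  shows "within (2 * (length rs + length out + length bs) + 4)
     (Main q, ls, Cell c # map Cell rs @ map Bit out @ z)
     (sstep' (Return q' r, ls, Tagged s # map Cell rs @ map Bit (out @ bs) @ [Blank]))"
proof -
  let ?t = "Tagged s" and ?mid = "map Cell rs @ map Bit out"
  have "within 1 (Main q, ls, Cell c # ?mid @ z) (Append q' r bs, ?t # ls, ?mid @ z)"
    using assms(3) by (intro within_step) (simp add: sstep_def)
  also have "within (length ?mid) (Append q' r bs, ?t # ls, ?mid @ z) (Append q' r bs, rev ?mid @ ?t # ls, z)"
    by (intro sim_scan_right) (cases bs; auto)+
  also have "within (length bs + 1) (Append q' r bs, rev ?mid @ ?t # ls, z)
      (Return q' r, rev (?mid @ map Bit bs) @ ?t # ls, [Blank])"
    using sim_append[OF assms(1)] by fastforce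
  also have "within (length (rev (?mid @ map Bit bs)) + 1)
      (Return q' r, rev (?mid @ map Bit bs) @ ?t # ls, [Blank])
      (Return q' r, ls, ?t # rev (rev (?mid @ map Bit bs)) @ [Blank])"
    by (intro sim_scan_left) auto
  \<comment> \<open>The last step stays unevaluated: it alone depends on the direction, and
    \<open>sim_right\<close> and \<open>sim_left\<close> compute it.\<close>
  also have "within 1 (Return q' r, ls, ?t # rev (rev (?mid @ map Bit bs)) @ [Blank])
      (sstep' (Return q' r, ls, ?t # ?mid @ map Bit bs @ [Blank]))"
    by (intro within_step) simp
  finally have "within (1 + length ?mid + (length bs + 1) + (length (rev (?mid @ map Bit bs)) + 1) + 1)
     (Main q, ls, Cell c # ?mid @ z) (sstep' (Return q' r, ls, ?t # ?mid @ map Bit bs @ [Blank]))" .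
  from within_mono[OF this, of "2 * (length rs + length out + length bs) + 4"] show ?thesis by simp
qed

definition kind :: "cell \<Rightarrow> bool \<times> bool" where
  "kind c = (c = LeftEnd, c = RightEnd)"

text \<open>Only the places of the end markers are recorded. Rewriting any other cell leaves the
  \<open>kind\<close> list unchanged, so the end conditions of the locale make this an invariant,
  and it keeps the head on the tape.\<close>

definition framed :: "cell list \<Rightarrow> cell list \<Rightarrow> bool" where
  "framed ls rs \<longleftrightarrow> rs \<noteq> [] \<and> (\<exists>m. map kind (rev ls @ rs) =
     (True, False) # replicate m (False, False) @ [(False, True)])"

lemma framed_initial: "framed [] (LeftEnd # map Plain x @ [RightEnd])"
  unfolding framed_def
  by (intro conjI exI[of _ "length x"]) (auto simp: kind_def map_replicate_const comp_def)

lemma framed_right_nonempty: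
  assumes "framed ls (c # rs)" "c \<noteq> RightEnd"
  shows "rs \<noteq> []"
proof
  assume "rs = []"
  then obtain m where "map kind (rev ls) @ [kind c] =
      ((True, False) # replicate m (False, False)) @ [(False, True)]"
    using assms(1) by (auto simp: framed_def)
  then show False using assms(2) by (simp only: append1_eq_conv) (simp add: kind_def)
qed

lemma framed_left_nonempty:
  assumes "framed ls (c # rs)" "c \<noteq> LeftEnd"
  shows "ls \<noteq> []"
  using assms by (auto simp: framed_def kind_def)

lemma framed_split:
  assumes "framed ls rs"
  obtains xs where "rs = xs @ [RightEnd]" "RightEnd \<notin> set xs"
proof -
  obtain ys c where rs: "rs = ys @ [c]" using assms by (cases rs rule: rev_cases) (auto simp: framed_def)
  then obtain m where "map kind (rev ls @ ys) @ [kind c] =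
      ((True, False) # replicate m (False, False)) @ [(False, True)]"
    using assms by (auto simp: framed_def)
  then have *: "map kind (rev ls @ ys) = (True, False) # replicate m (False, False)"
    and "kind c = (False, True)"
    by (simp_all only: append1_eq_conv)
  have "kind RightEnd \<notin> set (map kind (rev ls @ ys))"
    unfolding * by (auto simp: kind_def)
  then have "RightEnd \<notin> set ys" by auto
  with \<open>kind c = _\<close> rs that show thesis by (auto simp: kind_def)
qed

lemma sim_right:
  assumes "act q c = GoR q' s bs" "z = [] \<or> z = [Blank]" "rs \<noteq> []"
  shows "within (2 * (length rs + length out + length bs) + 4)
     (Main q, map Cell ls, map Cell (c # rs) @ map Bit out @ z)
     (Main q', map Cell (s # ls), map Cell rs @ map Bit (out @ bs) @ [Blank])"
  using sim_excursion[OF assms(2) refl, of q c q' True bs s rs out "map Cell ls"] assms(1)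
  by (simp add: sstep_def)

lemma sim_left:
  assumes "act q c = GoL q' s bs" "z = [] \<or> z = [Blank]"
  shows "within (2 * (length rs + length out + length bs) + 4)
     (Main q, map Cell (l # ls), map Cell (c # rs) @ map Bit out @ z)
     (Main q', map Cell ls, map Cell (l # s # rs) @ map Bit (out @ bs) @ [Blank])"
  using sim_excursion[OF assms(2) refl, of q c q' False bs s rs out "map Cell (l # ls)"] assms(1)
  by (simp add: sstep_def)

text \<open>The result is read from the head onwards, so the head must be moved to the cell just
  behind \<open>RightEnd\<close>, where the output begins.\<close>

lemma sim_halt:
  assumes "act q c = Halt" "framed ls (c # rs)"
  shows "\<exists>ls'. within (length rs + 3) (Main q, map Cell ls, map Cell (c # rs) @ ys) (Stop, ls', ys)"
proof -
  obtain xs where xs: "c # rs = xs @ [RightEnd]" "RightEnd \<notin> set xs"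
    using framed_split[OF assms(2)] .
  have "within 1 (Main q, map Cell ls, map Cell (c # rs) @ ys) (Finish, map Cell ls, map Cell (c # rs) @ ys)"
    using assms(1) by (intro within_step) (simp add: sstep_def)
  also have "within (length (map Cell xs)) (Finish, map Cell ls, map Cell (c # rs) @ ys)
      (Finish, rev (map Cell xs) @ map Cell ls, Cell RightEnd # ys)"
    unfolding xs using xs(2) sim_scan_right[of "map Cell xs" Finish "map Cell ls" "Cell RightEnd # ys"]
    by fastforce
  also have "within 1 \<dots> (Stop, Cell RightEnd # rev (map Cell xs) @ map Cell ls, ys)"
    by (intro within_step) (simp add: sstep_def)
  finally have run: "within (1 + length (map Cell xs) + 1) (Main q, map Cell ls, map Cell (c # rs) @ ys)
      (Stop, Cell RightEnd # rev (map Cell xs) @ map Cell ls, ys)" .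
  have "length xs = length rs" using arg_cong[OF xs(1), of length] by simp
  with within_mono[OF run, of "length rs + 3"] show ?thesis by auto
qed

text \<open>Induction on a bound \<open>R\<close> for the rank, which bounds the number of steps
  left. The tape length \<open>N\<close> is constant and the output never exceeds
  \<open>length out + B * R\<close>, so each step costs at most one trip over these cells and back;
  \<open>N + 3\<close> pays for halting.\<close>

lemma sim_run:
  assumes "framed ls rs" "z = [] \<or> z = [Blank]" "rank q ls rs \<le> R" "N = length ls + length rs"
  shows "\<exists>res ls' z'. yields act (q, ls, rs, out) res \<and> (z' = [] \<or> z' = [Blank]) \<and>
     within (R * (2 * (N + length out + B * R) + 5) + N + 3)
       (Main q, map Cell ls, map Cell rs @ map Bit out @ z) (Stop, ls', map Bit res @ z')"
  using assms
proof (induction R arbitrary: q ls rs out z)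
  case (0 q ls rs out z)
  obtain c rs' where rs: "rs = c # rs'" using 0(1) by (cases rs) (auto simp: framed_def)
  have halt: "act q c = Halt"
  proof (cases "act q c")
    case (GoL q' s bs)
    then obtain l ls' where "ls = l # ls'"
      using framed_left_nonempty[of ls c rs'] left_ends[OF GoL] 0(1) rs by (cases ls) auto
    then show ?thesis using left_rank[OF GoL, of ls' l rs'] 0(3) rs by simp
  next
    case (GoR q' s bs)
    then show ?thesis using right_rank[OF GoR, of ls rs'] 0(3) rs by simp
  qed
  obtain ls' where "within (length rs' + 3) (Main q, map Cell ls, map Cell rs @ map Bit out @ z)
      (Stop, ls', map Bit out @ z)"
    using sim_halt[OF halt, of ls rs'] 0(1) rs by auto
  from within_mono[OF this, of "N + 3"] show ?case
    using yields.halt[where act = act, OF halt] 0(2,4) rs by fastforce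
next
  case (Suc R q ls rs out z)
  obtain c rs' where rs: "rs = c # rs'" using Suc.prems(1) by (cases rs) (auto simp: framed_def)
  let ?T = "Suc R * (2 * (N + length out + B * Suc R) + 5) + N + 3"
  \<comment> \<open>The step appends at most \<open>B\<close> bits, and replacing
    \<open>B * R\<close> by \<open>B * Suc R\<close> in the bound accounts for carrying them through
    the remaining \<open>R\<close> steps.\<close>
  have cost: "2 * (length rs' + length out + n) + 4 + (R * (2 * (N + length (out @ bs) + B * R) + 5) + N + 3) \<le> ?T"
    if "n \<le> B" "length bs \<le> B" for n and bs :: "bool list"
  proof -
    have "R * length bs \<le> B * R" using that by simp
    then have le: "R * (length bs * 2) \<le> B * (R * 4)" by linarith
    show ?thesis
      using that(1) Suc.prems(4) rs by (simp add: algebra_simps) (use le in linarith)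
  qed
  show ?case
  proof (cases "act q c")
    case Halt
    obtain ls' where "within (length rs' + 3) (Main q, map Cell ls, map Cell rs @ map Bit out @ z)
        (Stop, ls', map Bit out @ z)"
      using sim_halt[OF Halt, of ls rs'] Suc.prems(1) rs by auto
    from within_mono[OF this, of ?T] show ?thesis
      using yields.halt[where act = act, OF Halt] Suc.prems(2,4) rs by fastforce
  next
    case (GoL q' s bs)
    then obtain l ls' where ls: "ls = l # ls'"
      using framed_left_nonempty[of ls c rs'] left_ends[OF GoL] Suc.prems(1) rs by (cases ls) auto
    have "framed ls' (l # s # rs')"
      using Suc.prems(1) left_ends[OF GoL] unfolding framed_def rs ls by (simp add: kind_def)
    moreover have "rank q' ls' (l # s # rs') \<le> R"
      using left_rank[OF GoL, of ls' l rs'] Suc.prems(3) rs ls by simp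
    ultimately obtain res ls'' z' where res: "yields act (q', ls', l # s # rs', out @ bs) res"
        "z' = [] \<or> z' = [Blank]"
      and run: "within (R * (2 * (N + length (out @ bs) + B * R) + 5) + N + 3)
        (Main q', map Cell ls', map Cell (l # s # rs') @ map Bit (out @ bs) @ [Blank])
        (Stop, ls'', map Bit res @ z')"
      using Suc.IH[of ls' "l # s # rs'" "[Blank]" q' "out @ bs"] Suc.prems(4) rs ls by auto
    from within_mono[OF within_trans[OF sim_left[OF GoL Suc.prems(2)] run] cost]
    show ?thesis using res left_length[OF GoL] yields_left[where act = act, OF GoL res(1)] unfolding rs ls by blast
  next
    case (GoR q' s bs)
    have ne: "rs' \<noteq> []"
      using framed_right_nonempty[of ls c rs'] right_ends[OF GoR] Suc.prems(1) rs by simp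
    then have "framed (s # ls) rs'"
      using Suc.prems(1) right_ends[OF GoR] unfolding framed_def rs by (simp add: kind_def)
    moreover have "rank q' (s # ls) rs' \<le> R"
      using right_rank[OF GoR, of ls rs'] Suc.prems(3) rs by simp
    ultimately obtain res ls'' z' where res: "yields act (q', s # ls, rs', out @ bs) res"
        "z' = [] \<or> z' = [Blank]"
      and run: "within (R * (2 * (N + length (out @ bs) + B * R) + 5) + N + 3)
        (Main q', map Cell (s # ls), map Cell rs' @ map Bit (out @ bs) @ [Blank])
        (Stop, ls'', map Bit res @ z')"
      using Suc.IH[of "s # ls" rs' "[Blank]" q' "out @ bs"] Suc.prems(4) rs by auto
    from within_mono[OF within_trans[OF sim_right[OF GoR Suc.prems(2) ne] run] cost]
    show ?thesis using res right_length[OF GoR] yields_right[where act = act, OF GoR ne res(1)] unfolding rs by blast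
  qed
qed

lemma sim_delta_closed: "p \<in> sim_states B \<Longrightarrow> fst (sim_delta act q0 p s) \<in> sim_states B"
proof (cases p)
  case (Main q)
  then show ?thesis
    using right_length left_length by (cases s) (auto split: action.split)
next
  case (Append q r bs)
  then show "p \<in> sim_states B \<Longrightarrow> ?thesis" by (cases s; cases bs) auto
qed (cases s; simp)+

lemma takeWhile_bits:
  assumes "z = [] \<or> z = [Blank]"
  shows "map (\<lambda>s. s = 2) (takeWhile (\<lambda>s. s = 1 \<or> s = 2) (map sym_num (map Bit bs @ z))) = bs"
  using assms by (induction bs) (auto simp: bit_sym_def)

text \<open>The simulation produces a result on every input, and \<open>F\<close> collects these
  results. By determinism any run exhibited separately must agree with \<open>F\<close>.\<close>

lemma poly_time:
  assumes "\<And>x. rank q0 [] (LeftEnd # map Plain x @ [RightEnd]) \<le> C * (length x + 1) ^ k"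
  shows "\<exists>F. poly_time_computable F \<and> (\<forall>x res. yields act (initial q0 x) res \<longrightarrow> F x = res)"
proof -
  obtain M and f :: "'q sim_state \<Rightarrow> nat"
    where M: "tm_wf M" "f Begin = 0" "f Stop = 1"
      "\<And>t c. fst c \<in> sim_states B \<Longrightarrow> (tm_step M ^^ t) (sconfig_num f c) = sconfig_num f ((sstep' ^^ t) c)"
    using tm_of_finite_states[of "sim_states B" Begin Stop "sim_delta act q0"]
      finite_sim_states sim_delta_closed by auto
  \<comment> \<open>The time is compared with the square of \<open>W = (n + 1) ^ (k + 1)\<close>;
    the exponent \<open>k + 1\<close> lets \<open>W\<close> dominate \<open>n + 1\<close> also for
    \<open>k = 0\<close>. The first summand of \<open>K\<close> bounds the simulated steps, the 9
    the setup and the final sweep.\<close>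
  define K where "K = C * (9 + 2 * (B * C)) + 9"
  have "\<exists>res. yields act (initial q0 x) res \<and> (\<exists>t \<le> K * (length x + 1) ^ (2 * (k + 1)).
      fst ((tm_step M ^^ t) (tm_init x)) = 1 \<and> tm_output ((tm_step M ^^ t) (tm_init x)) = res)" for x
  proof -
    define n R N W where "n = length x" and "R = C * (n + 1) ^ k" and "N = n + 2"
      and "W = (n + 1) ^ (k + 1)"
    let ?init = "LeftEnd # map Plain x @ [RightEnd]"
    have "framed [] ?init" "rank q0 [] ?init \<le> R" "N = length [] + length ?init"
      using framed_initial assms by (simp_all add: R_def N_def n_def)
    from sim_run[OF this(1) disjI1[OF refl] this(2,3), of "[]"] obtain res ls' z'
      where res: "yields act (initial q0 x) res" and z': "z' = [] \<or> z' = [Blank]"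
        and run: "within (R * (2 * (N + B * R) + 5) + N + 3)
          (Main q0, [], map Cell ?init) (Stop, ls', map Bit res @ z')"
      by (auto simp: initial_def)
    from within_trans[OF sim_setup run] obtain t
      where t: "t \<le> 2 * n + 4 + (R * (2 * (N + B * R) + 5) + N + 3)"
        "(sstep' ^^ t) (Begin, [], map Bit x) = (Stop, ls', map Bit res @ z')"
      unfolding within_def n_def by blast
    have "tm_init x = sconfig_num f (Begin, [], map Bit x)"
      using M(2) by (simp add: tm_init_def sconfig_num_def)
    then have "(tm_step M ^^ t) (tm_init x) = (1, map sym_num ls', map sym_num (map Bit res @ z'))"
      using M(3) M(4)[of "(Begin, [], map Bit x)" t] t(2) by (simp add: sconfig_num_def)
    moreover have "t \<le> K * (n + 1) ^ (2 * (k + 1))"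
    proof -
      have W: "n + 1 \<le> W" "(n + 1) ^ k \<le> W"
        unfolding W_def by (rule self_le_power; simp) (rule power_increasing; simp)
      have R: "R \<le> C * W" using W(2) by (simp add: R_def)
      have WW: "W \<le> W * W" using W(1) by (cases W) auto
      have "R * (2 * (N + B * R) + 5) \<le> (C * W) * (4 * W + 2 * (B * (C * W)) + 5 * W)"
      proof (intro mult_mono R)
        have "2 * (N + u) + 5 \<le> 4 * W + 2 * v + 5 * W" if "u \<le> v" for u v
          using that W(1) by (simp add: N_def)
        then show "2 * (N + B * R) + 5 \<le> 4 * W + 2 * (B * (C * W)) + 5 * W"
          using R by simp
      qed auto
      also have "\<dots> = C * (9 + 2 * (B * C)) * (W * W)" by (simp add: algebra_simps)
      finally have "R * (2 * (N + B * R) + 5) \<le> C * (9 + 2 * (B * C)) * (W * W)" .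
      moreover have "2 * n + 4 + (N + 3) \<le> 9 * (W * W)" using W(1) WW unfolding N_def by linarith
      ultimately have "t \<le> C * (9 + 2 * (B * C)) * (W * W) + 9 * (W * W)" using t(1) by linarith
      also have "\<dots> = K * (n + 1) ^ (2 * (k + 1))"
        by (simp only: K_def W_def add_mult_distrib mult_2 power_add)
      finally show ?thesis .
    qed
    ultimately show ?thesis
      using res takeWhile_bits[OF z', of res] by (auto simp: tm_output_def n_def intro!: exI[of _ t])
  qed
  then obtain F where F: "\<And>x. yields act (initial q0 x) (F x)"
    "\<And>x. \<exists>t \<le> K * (length x + 1) ^ (2 * (k + 1)).
      fst ((tm_step M ^^ t) (tm_init x)) = 1 \<and> tm_output ((tm_step M ^^ t) (tm_init x)) = F x"
    by metis
  then have "poly_time_computable F"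
    unfolding poly_time_computable_def using M(1) by blast
  with F(1) show ?thesis using yields_unique by blast
qed

end

section \<open>Computing the reduction\<close>

text \<open>This is \<open>bits_code\<close> without its terminator. It respects concatenation, so a
  word can be encoded piece by piece while it is being copied.\<close>

definition pairs :: "bool list \<Rightarrow> bool list" where
  "pairs w = concat (map (\<lambda>b. [True, b]) w)"

lemma pairs_simps [simp]:
  "pairs [] = []" "pairs (b # w) = True # b # pairs w" "pairs (v @ w) = pairs v @ pairs w"
  by (simp_all add: pairs_def)

lemma bits_code_pairs: "bits_code w = pairs w @ [False]"
  by (simp add: bits_code_def pairs_def)

lemma pairs_replicate_True: "pairs (replicate k True) = replicate (2 * k) True"
  by (induction k) auto

text \<open>In a unary word \<open>False\<close> occurs only as the terminator, so counting zeros
  counts words.\<close>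

lemma bits_code_unary: "bits_code (unary k) = replicate (2 * k) True @ [False]"
  by (simp add: bits_code_pairs unary_def pairs_replicate_True)

lemma code_simps [simp]:
  "code [] = []" "code (w # ws) = bits_code w @ code ws" "code (vs @ ws) = code vs @ code ws"
  by (simp_all add: code_def)

text \<open>Provides the unmarked zero just before the output count, at which \<open>FindCut\<close>
  stops.\<close>

lemma code_ends_with_False: "ws \<noteq> [] \<Longrightarrow> \<exists>y. code ws = y @ [False]"
  by (cases ws rule: rev_cases) (auto simp: bits_code_def)

text \<open>On the encoding of a circuit with \<open>n\<close> inputs, the last \<open>n\<close> words are the output count and
the \<open>n - 1\<close> output wires. All of them are unary, so they contain exactly \<open>n\<close> zeros, and the machine
finds the start of the output count by marking one zero from the right for every input. It replaces
that position by \<open>Cut\<close> and then, for every output wire, copies the part before \<open>Cut\<close> followed by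
the wire as the only output.\<close>

datatype reduce_state = Enter | Pair1 | Pair2 | ToEnd | MarkZero | Resume | FinalEnd | FindCut
  | PlaceCut | SkipCount | NextOut | Home | CopyHead | CopyOut

text \<open>Marking a pair of the input count also emits it, so the marking phase leaves the first
  word of the new instance, \<open>bits_code (unary n)\<close>, as output. The last three bits
  emitted for a wire are the encoded terminator of the wire and the terminator of the whole circuit
  word.\<close>

fun reduce_act :: "reduce_state \<Rightarrow> cell \<Rightarrow> reduce_state action" where
  "reduce_act Enter c = (if c = LeftEnd then GoR Pair1 c [] else Halt)"
| "reduce_act Pair1 c =
     (if c = Plain True then GoR Pair2 (Marked True) [True]
      else if c = Plain False then GoR FinalEnd c [False] else Halt)"
| "reduce_act Pair2 c = (if c = Plain True then GoR ToEnd (Marked True) [True] else Halt)"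
| "reduce_act ToEnd c = (if c = RightEnd then GoL MarkZero c [] else GoR ToEnd c [])"
| "reduce_act MarkZero c =
     (if c = LeftEnd then Halt else if c = Plain False then GoL Resume (Marked False) []
      else GoL MarkZero c [])"
| "reduce_act Resume c =
     (if c = LeftEnd then Halt else if c = Marked True then GoR Pair1 c [] else GoL Resume c [])"
| "reduce_act FinalEnd c = (if c = RightEnd then GoL FindCut c [] else GoR FinalEnd c [])"
| "reduce_act FindCut c =
     (if c = LeftEnd then Halt else if c = Plain False then GoR PlaceCut c [] else GoL FindCut c [])"
| "reduce_act PlaceCut c =
     (if c = Plain True then GoR SkipCount Cut []
      else if c = Marked False then GoR NextOut Cut [] else Halt)"
| "reduce_act SkipCount c =
     (if c = Plain True then GoR SkipCount Used []
      else if c = Marked False then GoR NextOut Used [] else Halt)"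
| "reduce_act NextOut c =
     (if c = Plain True \<or> c = Marked False then GoL Home c [] else Halt)"
| "reduce_act Home c = (if c = LeftEnd then GoR CopyHead c [] else GoL Home c [])"
| "reduce_act CopyHead c =
     (case c of
        Plain b \<Rightarrow> GoR CopyHead c [True, b]
      | Marked b \<Rightarrow> GoR CopyHead c [True, b]
      | Cut \<Rightarrow> GoR CopyOut c (pairs (bits_code (unary 1)))
      | _ \<Rightarrow> Halt)"
| "reduce_act CopyOut c =
     (if c = Used then GoR CopyOut c []
      else if c = Plain True then GoR CopyOut Used [True, True]
      else if c = Marked False then GoR NextOut Used [True, False, False] else Halt)"

instance reduce_state :: finite
proof
  have "x \<in> {Enter, Pair1, Pair2, ToEnd, MarkZero, Resume, FinalEnd, FindCut,
      PlaceCut, SkipCount, NextOut, Home, CopyHead, CopyOut}" for x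
    by (cases x) auto
  then have "(UNIV :: reduce_state set) \<subseteq> {Enter, Pair1, Pair2, ToEnd, MarkZero, Resume, FinalEnd,
      FindCut, PlaceCut, SkipCount, NextOut, Home, CopyHead, CopyOut}"
    by blast
  then show "finite (UNIV :: reduce_state set)" by (rule finite_subset) simp
qed

section \<open>Termination of the reduction machine on arbitrary tapes\<close>

fun weight :: "cell \<Rightarrow> nat" where
  "weight (Plain b) = 2"
| "weight (Marked b) = 1"
| "weight _ = 0"

text \<open>A cell is rewritten only from \<open>Plain\<close> towards \<open>Marked\<close>,
  \<open>Cut\<close> or \<open>Used\<close>, which lowers the weight. Between two rewritings the
  multiples of \<open>l + r + 1\<close> order the states, and the added \<open>l\<close> or
  \<open>r\<close> counts the cells left in a sweep. The value 0 belongs to states whose every move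
  lowers the weight.\<close>

fun reduce_phase :: "reduce_state \<Rightarrow> nat \<Rightarrow> nat \<Rightarrow> nat" where
  "reduce_phase Enter l r = 6 * (l + r + 1)"
| "reduce_phase Pair1 l r = 5 * (l + r + 1)"
| "reduce_phase Pair2 l r = 0"
| "reduce_phase ToEnd l r = 10 * (l + r + 1) + r"
| "reduce_phase MarkZero l r = 8 * (l + r + 1) + l"
| "reduce_phase Resume l r = 6 * (l + r + 1) + l"
| "reduce_phase FinalEnd l r = 3 * (l + r + 1) + r"
| "reduce_phase FindCut l r = (l + r + 1) + l"
| "reduce_phase PlaceCut l r = 0"
| "reduce_phase SkipCount l r = 0"
| "reduce_phase NextOut l r = 4 * (l + r + 1)"
| "reduce_phase Home l r = 2 * (l + r + 1) + l"
| "reduce_phase CopyHead l r = (l + r + 1) + r"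
| "reduce_phase CopyOut l r = r"

text \<open>Every cycle of the machine through its states lowers the weight of the tape, and 20 passes
over the tape bound the steps between two such decreases, whatever the input is.\<close>

definition reduce_rank :: "reduce_state \<Rightarrow> cell list \<Rightarrow> cell list \<Rightarrow> nat" where
  "reduce_rank q ls rs =
     20 * (length ls + length rs + 1) * (sum_list (map weight ls) + sum_list (map weight rs))
     + reduce_phase q (length ls) (length rs)"

text \<open>The 6 is the length of \<open>pairs (bits_code (unary 1))\<close>, the longest output of
  a single step.\<close>

interpretation reduction: output_machine reduce_act Enter 6 reduce_rank
proof
  fix q c q' s bs ls rs assume act: "reduce_act q c = GoR q' s bs"
  show "c \<noteq> RightEnd \<and> s \<noteq> RightEnd \<and> (s = LeftEnd \<longleftrightarrow> c = LeftEnd)"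
    using act by (cases q) (auto split: if_splits cell.splits)
  show "length bs \<le> 6"
    using act by (cases q) (auto simp: bits_code_unary numeral_eq_Suc split: if_splits cell.splits)
  show "reduce_rank q' (s # ls) rs < reduce_rank q ls (c # rs)"
    using act by (cases q) (auto simp: reduce_rank_def algebra_simps split: if_splits cell.splits)
next
  fix q c q' s bs l ls rs assume act: "reduce_act q c = GoL q' s bs"
  show "c \<noteq> LeftEnd \<and> s \<noteq> LeftEnd \<and> (s = RightEnd \<longleftrightarrow> c = RightEnd)"
    using act by (cases q) (auto split: if_splits cell.splits)
  show "length bs \<le> 6"
    using act by (cases q) (auto split: if_splits cell.splits)
  show "reduce_rank q' ls (l # s # rs) < reduce_rank q (l # ls) (c # rs)"
    using act by (cases q) (auto simp: reduce_rank_def algebra_simps split: if_splits cell.splits)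
qed

lemma reduce_rank_initial:
  "reduce_rank Enter [] (LeftEnd # map Plain x @ [RightEnd]) \<le> 200 * (length x + 1) ^ 2"
proof -
  have "sum_list (map (weight \<circ> Plain) x) = 2 * length x" by (induction x) auto
  then show ?thesis by (simp add: reduce_rank_def power2_eq_square algebra_simps)
qed

section \<open>Correctness of the reduction machine on encodings\<close>

definition plain_word :: "nat \<Rightarrow> cell list" where
  "plain_word k = replicate (2 * k) (Plain True) @ [Plain False]"

definition marked_word :: "nat \<Rightarrow> cell list" where
  "marked_word k = replicate (2 * k) (Plain True) @ [Marked False]"

lemma map_Plain_code_unary: "map Plain (code (map unary ks)) = concat (map plain_word ks)"
  by (induction ks) (auto simp: bits_code_unary plain_word_def)

lemma set_concat_marked_word: "set (concat (map marked_word ks)) \<subseteq> {Plain True, Marked False}"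
  by (auto simp: marked_word_def)

text \<open>Each round consumes one pair on the left and the last unmarked word on the right, hence
  the induction from the end of \<open>ks\<close>. \<open>ls\<close> and \<open>marked\<close>
  absorb what is done. As \<open>mid\<close> is unmarked, \<open>Resume\<close> stops only at the
  pair marked last.\<close>

lemma reduce_mark_zeros:
  assumes "set mid \<subseteq> range Plain" "set marked \<subseteq> {Plain True, Marked False}"
    "yields reduce_act (Pair1, replicate (2 * length ks) (Marked True) @ ls,
       mid @ concat (map marked_word ks) @ marked @ [RightEnd],
       out @ replicate (2 * length ks) True) res"
  shows "yields reduce_act (Pair1, ls, replicate (2 * length ks) (Plain True) @ mid @
     concat (map plain_word ks) @ marked @ [RightEnd], out) res"
  using assms(2,3)
proof (induction ks arbitrary: ls marked out rule: rev_induct)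
  case Nil
  then show ?case by simp
next
  case (snoc k ks)
  let ?pre = "replicate (2 * length ks) (Plain True) @ mid @ concat (map plain_word ks)
    @ replicate (2 * k) (Plain True)"
  let ?ls = "Marked True # Marked True # ls"
  have mid: "LeftEnd \<notin> set mid" "RightEnd \<notin> set mid" "Marked True \<notin> set mid"
    using assms(1) by auto
  have "yields reduce_act (Pair1, ?ls, replicate (2 * length ks) (Plain True) @ mid @
      concat (map plain_word ks) @ (marked_word k @ marked) @ [RightEnd], out @ [True, True]) res"
    using snoc.prems by (intro snoc.IH) (auto simp: marked_word_def replicate_app_Cons_same)
  then have "yields reduce_act (Pair1, ?ls, ?pre @ Marked False # marked @ [RightEnd],
      out @ [True, True]) res"
    by (simp add: marked_word_def)
  then have "yields reduce_act (Resume, Marked True # ls, Marked True # ?pre @ Marked False #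
      marked @ [RightEnd], out @ [True, True]) res"
    by - (rule yields_right[where act = reduce_act and q' = Pair1 and bs = "[]"]; auto)
  then have "yields reduce_act (MarkZero, rev ?pre @ ?ls, Plain False # marked @ [RightEnd],
      out @ [True, True]) res"
    using mid by - (rule yields_go_left[where q' = Resume and s = "Marked False" and bs = "[]"];
      (auto simp: plain_word_def split: if_splits))
  then have "yields reduce_act (ToEnd, rev marked @ Plain False # rev ?pre @ ?ls, [RightEnd],
      out @ [True, True]) res"
    using snoc.prems(1)
    by - (rule yields_go_left[where q' = MarkZero and s = RightEnd and bs = "[]"]; auto)
  then have "yields reduce_act (ToEnd, ?ls, (?pre @ Plain False # marked) @ [RightEnd],
      out @ [True, True]) res"
    using mid snoc.prems(1) by - (rule yields_scan_right; (auto simp: plain_word_def split: if_splits))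
  then have "yields reduce_act (Pair2, Marked True # ls, Plain True # ?pre @ Plain False # marked @ [RightEnd],
      out @ [True]) res"
    by - (rule yields_right[where q' = ToEnd and s = "Marked True" and bs = "[True]"]; auto)
  then have "yields reduce_act (Pair1, ls, Plain True # Plain True # ?pre @ Plain False # marked @ [RightEnd],
      out) res"
    by - (rule yields_right[where q' = Pair2 and s = "Marked True" and bs = "[True]"]; auto)
  then show ?case by (simp add: plain_word_def[of k])
qed

text \<open>\<open>Cut\<close> takes the first cell of the output count. For the count 0 this cell
  is already the marked terminator, and nothing is left to skip.\<close>

lemma reduce_place_cut:
  assumes "yields reduce_act (NextOut, replicate (2 * k) Used @ Cut # ls, ys, out) res" "ys \<noteq> []"
  shows "yields reduce_act (PlaceCut, ls, marked_word k @ ys, out) res"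
proof (cases k)
  case 0
  then show ?thesis
    using assms by (auto simp: marked_word_def
      intro!: yields_right[where q' = NextOut and s = Cut and bs = "[]"])
next
  case (Suc j)
  then have "replicate (2 * k) Used = Used # replicate (Suc (2 * j)) Used" by simp
  with assms have "yields reduce_act (SkipCount, replicate (Suc (2 * j)) Used @ Cut # ls,
      Marked False # ys, out) res"
    by - (rule yields_right[where q' = NextOut and s = Used and bs = "[]"]; auto)
  then have "yields reduce_act (SkipCount, Cut # ls,
      replicate (Suc (2 * j)) (Plain True) @ Marked False # ys, out) res"
    by - (rule yields_pass_right[where g = "\<lambda>_. Used" and h = "\<lambda>_. []"];
      (auto simp: replicate_app_Cons_same))
  then have "yields reduce_act (PlaceCut, ls,
      Plain True # replicate (Suc (2 * j)) (Plain True) @ Marked False # ys, out) res"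
    by - (rule yields_right[where q' = SkipCount and s = Cut and bs = "[]"]; auto)
  then show ?thesis by (simp add: marked_word_def Suc)
qed

fun cell_bit :: "cell \<Rightarrow> bool" where
  "cell_bit (Plain b) = b"
| "cell_bit (Marked b) = b"
| "cell_bit _ = False"

text \<open>A wire that has been copied turns into \<open>2 * k + 1\<close> further
  \<open>Used\<close> cells behind \<open>Cut\<close>; the induction is therefore over all
  \<open>j\<close>.\<close>

lemma reduce_outputs:
  assumes "set hs \<subseteq> range Plain \<union> range Marked"
  shows "yields reduce_act (NextOut, replicate j Used @ Cut # rev hs @ [LeftEnd],
      concat (map marked_word os) @ [RightEnd], out)
    (out @ concat (map (\<lambda>k. bits_code (map cell_bit hs @ code [unary 1, unary k])) os))"
proof (induction os arbitrary: j out)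
  case Nil
  then show ?case by (auto intro: yields.halt)
next
  case (Cons k os)
  let ?rest = "concat (map marked_word os) @ [RightEnd]"
  let ?ls = "Cut # rev hs @ [LeftEnd]"
  let ?out1 = "out @ pairs (map cell_bit hs)"
  let ?out2 = "?out1 @ pairs (bits_code (unary 1))"
  let ?out3 = "?out2 @ pairs (replicate (2 * k) True)"
  let ?res = "out @ concat (map (\<lambda>k. bits_code (map cell_bit hs @ code [unary 1, unary k])) (k # os))"
  have "yields reduce_act (NextOut, replicate (Suc (2 * k + j)) Used @ ?ls, ?rest,
      ?out3 @ [True, False, False]) ?res"
    using Cons.IH[of "Suc (2 * k + j)" "?out3 @ [True, False, False]"]
    by (simp add: bits_code_pairs unary_def pairs_replicate_True)
  then have "yields reduce_act (CopyOut, replicate (2 * k) Used @ replicate j Used @ ?ls,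
      Marked False # ?rest, ?out3) ?res"
    by - (rule yields_right[where q' = NextOut and s = Used and bs = "[True, False, False]"];
      (auto simp: replicate_add))
  then have "yields reduce_act (CopyOut, replicate j Used @ ?ls,
      replicate (2 * k) (Plain True) @ Marked False # ?rest, ?out2) ?res"
    by - (rule yields_pass_right[where g = "\<lambda>_. Used" and h = "\<lambda>_. [True, True]"];
      (auto simp: pairs_def))
  then have "yields reduce_act (CopyOut, ?ls,
      replicate j Used @ replicate (2 * k) (Plain True) @ Marked False # ?rest, ?out2) ?res"
    by - (rule yields_scan_right[where xs = "replicate j Used"]; auto)
  then have "yields reduce_act (CopyHead, rev hs @ [LeftEnd],
      Cut # replicate j Used @ replicate (2 * k) (Plain True) @ Marked False # ?rest, ?out1) ?res"
    by - (rule yields_right[where q' = CopyOut and s = Cut and bs = "pairs (bits_code (unary 1))"]; auto)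
  then have "yields reduce_act (CopyHead, [LeftEnd],
      hs @ Cut # replicate j Used @ replicate (2 * k) (Plain True) @ Marked False # ?rest, out) ?res"
    using assms
    by - (rule yields_pass_right[where g = "\<lambda>c. c" and h = "\<lambda>c. [True, cell_bit c]"];
      (auto simp: pairs_def comp_def))
  then have home: "yields reduce_act (Home, [],
      LeftEnd # hs @ Cut # replicate j Used @ replicate (2 * k) (Plain True) @ Marked False # ?rest, out) ?res"
    by - (rule yields_right[where q' = CopyHead and s = LeftEnd and bs = "[]"]; auto)
  \<comment> \<open>The word of wire 0 consists of its terminator alone, so the next wire may begin
    with either symbol; \<open>NextOut\<close> accepts both.\<close>
  obtain c cs where cs: "replicate (2 * k) (Plain True) @ Marked False # ?rest = c # cs"
      "c = Plain True \<or> c = Marked False"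
    by (cases k) auto
  have "yields reduce_act (NextOut, (replicate j Used @ Cut # rev hs) @ LeftEnd # [], c # cs, out) ?res"
    using home assms cs
    by - (rule yields_go_left[where q' = Home and s = c and bs = "[]"]; auto)
  moreover have "concat (map marked_word (k # os)) @ [RightEnd] = c # cs"
    using cs(1) by (simp add: marked_word_def[of k])
  ultimately show ?case by (simp only: append_assoc append_Cons append_Nil)
qed

text \<open>\<open>ws\<close> stands for the gate count and the gates, \<open>k\<close> for the
  output count and \<open>os\<close> for the output wires. The relation between inputs and outputs
  enters as \<open>n = Suc (length os)\<close>: the \<open>n\<close> marked zeros end exactly the
  words \<open>k # os\<close>.\<close>

lemma reduce_yields:
  fixes os :: "nat list"
  assumes "code ws = y @ [False]"
  defines "n \<equiv> Suc (length os)"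
  shows "yields reduce_act (initial Enter (code (unary n # ws @ map unary (k # os))))
    (code (unary n # map (\<lambda>k. code (unary n # ws @ [unary 1, unary k])) os))"
proof -
  let ?hd = "replicate (2 * n) (Marked True) @ Plain False # map Plain y @ [Plain False]"
  let ?res = "code (unary n # map (\<lambda>k. code (unary n # ws @ [unary 1, unary k])) os)"
  let ?out = "replicate (2 * n) True @ [False]"
  let ?mid = "Plain False # map Plain y @ [Plain False]"
  let ?tail = "concat (map marked_word (k # os))"
  let ?rest = "concat (map marked_word os) @ [RightEnd]"
  let ?ls = "Plain False # replicate (2 * n) (Marked True) @ [LeftEnd]"
  have res: "?res = ?out @
      concat (map (\<lambda>k. bits_code (map cell_bit ?hd @ code [unary 1, unary k])) os)"
    using assms(1) by (simp add: code_def bits_code_unary comp_def)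
  have "set ?hd \<subseteq> range Plain \<union> range Marked" by auto
  from reduce_outputs[OF this, of "2 * k" os ?out]
  have "yields reduce_act (PlaceCut, rev ?hd @ [LeftEnd], marked_word k @ ?rest, ?out) ?res"
    unfolding res by (intro reduce_place_cut) simp_all
  then have "yields reduce_act (FindCut, rev (map Plain y) @ ?ls, Plain False # ?tail @ [RightEnd], ?out) ?res"
    by - (rule yields_right[where q' = PlaceCut and s = "Plain False" and bs = "[]"]; auto)
  then have "yields reduce_act (FinalEnd, rev ?tail @ Plain False # rev (map Plain y) @ ?ls, [RightEnd], ?out) ?res"
    using set_concat_marked_word[of "k # os"]
    by - (rule yields_go_left[where q' = FindCut and s = RightEnd and bs = "[]"]; auto)
  then have "yields reduce_act (FinalEnd, ?ls, (map Plain y @ Plain False # ?tail) @ [RightEnd], ?out) ?res"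
    using set_concat_marked_word[of "k # os"] by - (rule yields_scan_right; auto)
  then have "yields reduce_act (Pair1, replicate (2 * length (k # os)) (Marked True) @ [LeftEnd],
      ?mid @ ?tail @ [] @ [RightEnd], [] @ replicate (2 * length (k # os)) True) ?res"
    by (auto simp: n_def intro!: yields_right[where q' = FinalEnd and s = "Plain False" and bs = "[False]"])
  then have "yields reduce_act (Pair1, [LeftEnd], replicate (2 * length (k # os)) (Plain True) @ ?mid @
      concat (map plain_word (k # os)) @ [] @ [RightEnd], []) ?res"
    by (intro reduce_mark_zeros) auto
  then have "yields reduce_act (Enter, [], LeftEnd # replicate (2 * length (k # os)) (Plain True) @ ?mid @
      concat (map plain_word (k # os)) @ [] @ [RightEnd], []) ?res"
    by - (rule yields_right[where q' = Pair1 and s = LeftEnd and bs = "[]"]; auto)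
  moreover have "map Plain (code (unary n # ws @ map unary (k # os))) =
      replicate (2 * length (k # os)) (Plain True) @ ?mid @ concat (map plain_word (k # os))"
    using assms(1) map_Plain_code_unary[of "k # os"] by (simp add: bits_code_unary n_def)
  ultimately show ?thesis by (simp add: initial_def)
qed

section \<open>Recovering the collision\<close>

text \<open>The sequence of words is encoded twice in the input. The machine marks the beginning of each
of its words and then decodes from the last but one mark.\<close>

datatype extract_state = Start | SkipTag | SkipBit | WordTag | LeadBit | BodyTag | BodyBit | LeadTag
  | LastWord | PrevWord | EmitTag | EmitBit

text \<open>In the twice encoded sequence a bit \<open>b\<close> of a word fills the cells True,
  True, True, \<open>b\<close>, and the end of a word True, False; the states from
  \<open>WordTag\<close> to \<open>LeadTag\<close> follow this pattern. Dropping the outer tags from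
  the last but one mark on leaves \<open>code\<close> of the last two words.\<close>

fun extract_act :: "extract_state \<Rightarrow> cell \<Rightarrow> extract_state action" where
  "extract_act Start c = (if c = LeftEnd then GoR SkipTag c [] else Halt)"
| "extract_act SkipTag c =
     (case c of Plain b \<Rightarrow> GoR (if b then SkipBit else WordTag) c [] | _ \<Rightarrow> Halt)"
| "extract_act SkipBit c = (case c of Plain b \<Rightarrow> GoR SkipTag c [] | _ \<Rightarrow> Halt)"
| "extract_act WordTag c =
     (if c = Plain True then GoR LeadBit (Marked True) []
      else if c = Plain False then GoL LastWord c [] else Halt)"
| "extract_act LeadBit c =
     (case c of Plain b \<Rightarrow> GoR (if b then BodyTag else WordTag) c [] | _ \<Rightarrow> Halt)"
| "extract_act BodyTag c = (if c = Plain True then GoR BodyBit c [] else Halt)"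
| "extract_act BodyBit c = (case c of Plain b \<Rightarrow> GoR LeadTag c [] | _ \<Rightarrow> Halt)"
| "extract_act LeadTag c = (if c = Plain True then GoR LeadBit c [] else Halt)"
| "extract_act LastWord c =
     (if c = LeftEnd then Halt else if c = Marked True then GoL PrevWord c [] else GoL LastWord c [])"
| "extract_act PrevWord c =
     (if c = LeftEnd then Halt else if c = Marked True then GoR EmitBit c [] else GoL PrevWord c [])"
| "extract_act EmitTag c =
     (if c = Plain True \<or> c = Marked True then GoR EmitBit c [] else Halt)"
| "extract_act EmitBit c = (case c of Plain b \<Rightarrow> GoR EmitTag c [b] | _ \<Rightarrow> Halt)"

instance extract_state :: finite
proof
  have "x \<in> {Start, SkipTag, SkipBit, WordTag, LeadBit, BodyTag, BodyBit, LeadTag,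
      LastWord, PrevWord, EmitTag, EmitBit}" for x
    by (cases x) auto
  then have "(UNIV :: extract_state set) \<subseteq> {Start, SkipTag, SkipBit, WordTag, LeadBit, BodyTag,
      BodyBit, LeadTag, LastWord, PrevWord, EmitTag, EmitBit}"
    by blast
  then show "finite (UNIV :: extract_state set)" by (rule finite_subset) simp
qed

text \<open>A run is a right sweep that marks, a left sweep shared by \<open>LastWord\<close> and
  \<open>PrevWord\<close>, and a right sweep that emits. The coefficients 4, 3, 2 order these
  phases, as a sweep counter never exceeds \<open>n\<close>.\<close>

definition extract_rank :: "extract_state \<Rightarrow> cell list \<Rightarrow> cell list \<Rightarrow> nat" where
  "extract_rank q ls rs =
     (let l = length ls; r = length rs; n = l + r in
      if q = LastWord then 3 * n + l else if q = PrevWord then 2 * n + l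
      else if q = EmitTag \<or> q = EmitBit then r else 4 * n + r)"

interpretation extraction: output_machine extract_act Start 1 extract_rank
proof
  fix q c q' s bs ls rs assume act: "extract_act q c = GoR q' s bs"
  show "c \<noteq> RightEnd \<and> s \<noteq> RightEnd \<and> (s = LeftEnd \<longleftrightarrow> c = LeftEnd)"
    using act by (cases q) (auto split: if_splits cell.splits)
  show "length bs \<le> 1"
    using act by (cases q) (auto split: if_splits cell.splits)
  show "extract_rank q' (s # ls) rs < extract_rank q ls (c # rs)"
    using act by (cases q) (auto simp: extract_rank_def Let_def split: if_splits cell.splits)
next
  fix q c q' s bs l ls rs assume act: "extract_act q c = GoL q' s bs"
  show "c \<noteq> LeftEnd \<and> s \<noteq> LeftEnd \<and> (s = RightEnd \<longleftrightarrow> c = RightEnd)"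
    using act by (cases q) (auto split: if_splits cell.splits)
  show "length bs \<le> 1"
    using act by (cases q) (auto split: if_splits cell.splits)
  show "extract_rank q' ls (l # s # rs) < extract_rank q (l # ls) (c # rs)"
    using act by (cases q) (auto simp: extract_rank_def Let_def split: if_splits cell.splits)
qed

lemma extract_rank_initial:
  "extract_rank Start [] (LeftEnd # map Plain x @ [RightEnd]) \<le> 10 * (length x + 1) ^ 1"
  by (simp add: extract_rank_def)

section \<open>Correctness of the extraction machine\<close>

definition lead_cells :: "bool list \<Rightarrow> cell list" where
  "lead_cells a = Marked True # map Plain (tl (pairs (bits_code a)))"

lemma extract_skip:
  assumes "yields extract_act (SkipTag, rev (map Plain (pairs w)) @ ls, ys, out) res" "ys \<noteq> []"
  shows "yields extract_act (SkipTag, ls, map Plain (pairs w) @ ys, out) res"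
  using assms(1)
proof (induction w arbitrary: ls)
  case (Cons b w)
  then have "yields extract_act (SkipTag, Plain b # Plain True # ls, map Plain (pairs w) @ ys, out) res"
    by (intro Cons.IH) simp
  then have "yields extract_act (SkipBit, Plain True # ls, Plain b # map Plain (pairs w) @ ys, out) res"
    using assms(2) by - (rule yields_right[where q' = SkipTag and s = "Plain b" and bs = "[]"]; auto)
  then have "yields extract_act (SkipTag, ls, Plain True # Plain b # map Plain (pairs w) @ ys, out) res"
    by - (rule yields_right[where q' = SkipBit and s = "Plain True" and bs = "[]"]; auto)
  then show ?case by simp
qed simp

lemma extract_body:
  assumes "yields extract_act (LeadTag, rev (map Plain (pairs (pairs w))) @ ls, ys, out) res" "ys \<noteq> []"
  shows "yields extract_act (LeadTag, ls, map Plain (pairs (pairs w)) @ ys, out) res"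
  using assms(1)
proof (induction w arbitrary: ls)
  case (Cons b w)
  let ?t = "Plain True" and ?xs = "map Plain (pairs (pairs w)) @ ys"
  have "yields extract_act (LeadTag, Plain b # ?t # ?t # ?t # ls, ?xs, out) res"
    using Cons.prems by (intro Cons.IH) simp
  then have "yields extract_act (BodyBit, ?t # ?t # ?t # ls, Plain b # ?xs, out) res"
    using assms(2) by - (rule yields_right[where q' = LeadTag and s = "Plain b" and bs = "[]"]; auto)
  then have "yields extract_act (BodyTag, ?t # ?t # ls, ?t # Plain b # ?xs, out) res"
    by - (rule yields_right[where q' = BodyBit and s = ?t and bs = "[]"]; auto)
  then have "yields extract_act (LeadBit, ?t # ls, ?t # ?t # Plain b # ?xs, out) res"
    by - (rule yields_right[where q' = BodyTag and s = ?t and bs = "[]"]; auto)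
  then have "yields extract_act (LeadTag, ls, ?t # ?t # ?t # Plain b # ?xs, out) res"
    by - (rule yields_right[where q' = LeadBit and s = ?t and bs = "[]"]; auto)
  then show ?case by simp
qed simp

lemma extract_word:
  assumes "yields extract_act (WordTag, rev (lead_cells a) @ ls, ys, out) res" "ys \<noteq> []"
  shows "yields extract_act (WordTag, ls, map Plain (pairs (bits_code a)) @ ys, out) res"
proof (cases a)
  case Nil
  let ?t = "Plain True"
  have "yields extract_act (LeadBit, Marked True # ls, Plain False # ys, out) res"
    using assms by - (rule yields_right[where q' = WordTag and s = "Plain False" and bs = "[]"];
      (auto simp: Nil lead_cells_def bits_code_pairs))
  then have "yields extract_act (WordTag, ls, Plain True # Plain False # ys, out) res"
    by - (rule yields_right[where q' = LeadBit and s = "Marked True" and bs = "[]"]; auto)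
  then show ?thesis by (simp add: Nil bits_code_pairs)
next
  case (Cons b w)
  let ?t = "Plain True" and ?f = "Plain False"
  let ?xs = "map Plain (pairs (pairs w))"
  let ?ls = "Plain b # ?t # ?t # Marked True # ls"
  have "yields extract_act (LeadBit, ?t # rev ?xs @ ?ls, ?f # ys, out) res"
    using assms by - (rule yields_right[where q' = WordTag and s = ?f and bs = "[]"];
      (auto simp: Cons lead_cells_def bits_code_pairs))
  then have "yields extract_act (LeadTag, rev ?xs @ ?ls, ?t # ?f # ys, out) res"
    by - (rule yields_right[where q' = LeadBit and s = ?t and bs = "[]"]; auto)
  then have "yields extract_act (LeadTag, ?ls, ?xs @ ?t # ?f # ys, out) res"
    by (intro extract_body) auto
  then have "yields extract_act (BodyBit, ?t # ?t # Marked True # ls, Plain b # ?xs @ ?t # ?f # ys, out) res"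
    by - (rule yields_right[where q' = LeadTag and s = "Plain b" and bs = "[]"]; auto)
  then have "yields extract_act (BodyTag, ?t # Marked True # ls, ?t # Plain b # ?xs @ ?t # ?f # ys, out) res"
    by - (rule yields_right[where q' = BodyBit and s = ?t and bs = "[]"]; auto)
  then have "yields extract_act (LeadBit, Marked True # ls, ?t # ?t # Plain b # ?xs @ ?t # ?f # ys, out) res"
    by - (rule yields_right[where q' = BodyTag and s = ?t and bs = "[]"]; auto)
  then have "yields extract_act (WordTag, ls, ?t # ?t # ?t # Plain b # ?xs @ ?t # ?f # ys, out) res"
    by - (rule yields_right[where q' = LeadBit and s = "Marked True" and bs = "[]"]; auto)
  then show ?thesis by (simp add: Cons bits_code_pairs)
qed

lemma extract_words:
  assumes "yields extract_act (WordTag, rev (concat (map lead_cells as)) @ ls, ys, out) res" "ys \<noteq> []"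
  shows "yields extract_act (WordTag, ls, map Plain (pairs (code as)) @ ys, out) res"
  using assms(1)
proof (induction as arbitrary: ls)
  case (Cons a as)
  then have "yields extract_act (WordTag, rev (lead_cells a) @ ls, map Plain (pairs (code as)) @ ys, out) res"
    by (intro Cons.IH) simp
  from extract_word[OF this] show ?case using assms(2) by simp
qed simp

lemma extract_emit:
  assumes "\<And>ls. yields extract_act (EmitTag, ls, ys, out @ w) res" "ys \<noteq> []"
  shows "yields extract_act (EmitTag, ls, map Plain (pairs w) @ ys, out) res"
  using assms(1)
proof (induction w arbitrary: ls out)
  case (Cons b w)
  have "yields extract_act (EmitTag, Plain b # Plain True # ls, map Plain (pairs w) @ ys, out @ [b]) res"
    using Cons.prems by (intro Cons.IH) simp
  then have "yields extract_act (EmitBit, Plain True # ls, Plain b # map Plain (pairs w) @ ys, out) res"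
    using assms(2) by - (rule yields_right[where q' = EmitTag and s = "Plain b" and bs = "[b]"]; auto)
  then have "yields extract_act (EmitTag, ls, Plain True # Plain b # map Plain (pairs w) @ ys, out) res"
    by - (rule yields_right[where q' = EmitBit and s = "Plain True" and bs = "[]"]; auto)
  then show ?case by simp
qed simp

text \<open>The state \<open>q\<close> is \<open>PrevWord\<close> for the first emitted word,
  reached from the right, and \<open>EmitTag\<close> for the second, reached from the first.\<close>

lemma extract_emit_word:
  assumes "extract_act q (Marked True) = GoR EmitBit (Marked True) []"
    "\<And>ls. yields extract_act (EmitTag, ls, ys, out @ bits_code a) res" "ys \<noteq> []"
  shows "yields extract_act (q, ls, lead_cells a @ ys, out) res"
proof -
  obtain b w where a: "bits_code a = b # w" by (cases "bits_code a") (auto simp: bits_code_def)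
  have "yields extract_act (EmitTag, Plain b # Marked True # ls, map Plain (pairs w) @ ys, out @ [b]) res"
    using assms(2,3) by (intro extract_emit) (simp_all add: a)
  then have "yields extract_act (EmitBit, Marked True # ls, Plain b # map Plain (pairs w) @ ys, out) res"
    using assms(3) by - (rule yields_right[where q' = EmitTag and s = "Plain b" and bs = "[b]"]; auto)
  then have "yields extract_act (q, ls, Marked True # Plain b # map Plain (pairs w) @ ys, out) res"
    using assms(1) by - (rule yields_right[where q' = EmitBit and s = "Marked True" and bs = "[]"]; auto)
  then show ?thesis by (simp add: lead_cells_def a)
qed

lemma extract_yields:
  "yields extract_act (initial Start (code [w, code (as @ [u, v])])) (code [u, v])"
proof -
  let ?end = "[Plain False, RightEnd]"
  let ?lead = "\<lambda>a. map Plain (tl (pairs (bits_code a)))"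
  let ?ls = "rev (concat (map lead_cells as)) @ Plain False # rev (map Plain (pairs w)) @ [LeftEnd]"
  have "yields extract_act (EmitTag, ls, ?end, [] @ bits_code u @ bits_code v) (code [u, v])" for ls
    by (auto intro: yields.halt)
  then have "yields extract_act (EmitTag, ls, lead_cells v @ ?end, [] @ bits_code u) (code [u, v])" for ls
    by - (rule extract_emit_word; auto)
  then have "yields extract_act (PrevWord, ?ls, lead_cells u @ lead_cells v @ ?end, []) (code [u, v])"
    by - (rule extract_emit_word; auto simp: lead_cells_def)
  then have "yields extract_act (LastWord, rev (?lead u) @ Marked True # ?ls, Marked True # ?lead v @ ?end, [])
      (code [u, v])"
    by - (rule yields_go_left[where q' = PrevWord and s = "Marked True" and bs = "[]"];
      (auto simp: lead_cells_def))
  then have "yields extract_act (WordTag, rev (?lead v) @ Marked True # rev (?lead u) @ Marked True # ?ls,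
      ?end, []) (code [u, v])"
    by - (rule yields_go_left[where q' = LastWord and s = "Plain False" and bs = "[]"]; auto)
  then have "yields extract_act (WordTag, Plain False # rev (map Plain (pairs w)) @ [LeftEnd],
      map Plain (pairs (code (as @ [u, v]))) @ ?end, []) (code [u, v])"
    by (intro extract_words) (simp_all add: lead_cells_def)
  then have "yields extract_act (SkipTag, rev (map Plain (pairs w)) @ [LeftEnd],
      Plain False # map Plain (pairs (code (as @ [u, v]))) @ ?end, []) (code [u, v])"
    by - (rule yields_right[where q' = WordTag and s = "Plain False" and bs = "[]"]; auto)
  then have "yields extract_act (SkipTag, [LeftEnd], map Plain (pairs w) @
      Plain False # map Plain (pairs (code (as @ [u, v]))) @ ?end, []) (code [u, v])"
    by (intro extract_skip) auto
  then have "yields extract_act (Start, [], LeftEnd # map Plain (pairs w) @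
      Plain False # map Plain (pairs (code (as @ [u, v]))) @ ?end, []) (code [u, v])"
    by - (rule yields_right[where q' = SkipTag and s = LeftEnd and bs = "[]"]; auto)
  then show ?thesis by (simp add: initial_def bits_code_pairs)
qed

section \<open>The reduction\<close>

text \<open>Each predicate keeps all gates of C and selects one output wire; its encoding thus
  agrees with that of C up to the output count.\<close>

definition output_bits :: "circuit \<Rightarrow> circuit list" where
  "output_bits C = map (\<lambda>k. Circuit (c_nin C) (c_gates C) [k]) (c_outs C)"

lemma ulc_instance_output_bits:
  "pwpp_instance C \<Longrightarrow> ulc_instance (c_nin C) (output_bits C)"
  by (auto simp: pwpp_instance_def ulc_instance_def output_bits_def)

lemma ulc_pred_output_bits:
  assumes "i < length (c_outs C)"
  shows "ulc_pred (output_bits C ! i) x = eval_circuit C x ! i"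
  using assms by (simp add: ulc_pred_def output_bits_def eval_circuit_def Let_def)

lemma last_two_collide:
  assumes "pwpp_instance C" "ulc_solution (c_nin C) (output_bits C) as"
  obtains bs x y where "as = bs @ [x, y]" "pwpp_solution C x y"
proof -
  define n where "n = c_nin C"
  have n: "1 \<le> n" "length (c_outs C) = n - 1" using assms(1) by (simp_all add: n_def pwpp_instance_def)
  have sol: "length as = n + 1" "distinct as" "\<forall>a\<in>set as. length a = n"
    "\<And>i j k. i + 2 \<le> n \<Longrightarrow> i < j \<Longrightarrow> j \<le> n \<Longrightarrow> i < k \<Longrightarrow> k \<le> n \<Longrightarrow>
      ulc_pred (output_bits C ! i) (as ! j) = ulc_pred (output_bits C ! i) (as ! k)"
    using assms(2) unfolding ulc_solution_def n_def by blast+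
  obtain cs y where cs: "as = cs @ [y]" using sol(1) by (cases as rule: rev_cases) auto
  moreover obtain bs x where "cs = bs @ [x]" using sol(1) cs n(1) by (cases cs rule: rev_cases) auto
  ultimately have as: "as = bs @ [x, y]" by simp
  then have "n = Suc (length bs)" using sol(1) by simp
  then have nth: "as ! (n - 1) = x" "as ! n = y" by (simp_all add: as nth_append)
  have "eval_circuit C x = eval_circuit C y"
  proof (rule nth_equalityI)
    fix i assume "i < length (eval_circuit C x)"
    then have "i < n - 1" by (simp add: eval_circuit_def Let_def n)
    \<comment> \<open>From \<open>i < n - 1\<close> follow \<open>i + 2 \<le> n\<close> and that
      both positions \<open>n - 1\<close> and \<open>n\<close> lie beyond \<open>i\<close>.\<close>
    moreover from this
    have "ulc_pred (output_bits C ! i) (as ! (n - 1)) = ulc_pred (output_bits C ! i) (as ! n)"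
      by (intro sol(4)) linarith+
    ultimately show "eval_circuit C x ! i = eval_circuit C y ! i"
      unfolding nth by (simp add: ulc_pred_output_bits n)
  qed (simp add: eval_circuit_def Let_def)
  then have "pwpp_solution C x y"
    using sol(2,3) by (simp add: pwpp_solution_def as n_def)
  then show thesis using that as by blast
qed

lemma reduce_circuit:
  assumes "pwpp_instance C"
  shows "yields reduce_act (initial Enter (enc_circuit C)) (enc_ulc (c_nin C) (output_bits C))"
proof -
  define ws where "ws = unary (length (c_gates C)) # concat (map gate_words (c_gates C))"
  obtain y where y: "code ws = y @ [False]" using code_ends_with_False[of ws] by (auto simp: ws_def)
  have n: "c_nin C = Suc (length (c_outs C))" using assms by (simp add: pwpp_instance_def)
  have "enc_circuit C = code (unary (c_nin C) # ws @ map unary (length (c_outs C) # c_outs C))"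
    by (simp add: enc_circuit_def ws_def)
  moreover have "enc_ulc (c_nin C) (output_bits C) =
      code (unary (c_nin C) # map (\<lambda>k. code (unary (c_nin C) # ws @ [unary 1, unary k])) (c_outs C))"
    by (simp add: enc_ulc_def output_bits_def enc_circuit_def ws_def comp_def)
  ultimately show ?thesis
    using reduce_yields[OF y, of "c_outs C" "length (c_outs C)"] by (simp only: n)
qed

theorem theorem3:
  "\<exists>F G. poly_time_computable F \<and> poly_time_computable G \<and>
     (\<forall>C. pwpp_instance C \<longrightarrow>
        (\<exists>n Ps. ulc_instance n Ps \<and> F (enc_circuit C) = enc_ulc n Ps \<and>
           (\<forall>as. ulc_solution n Ps as \<longrightarrow>
              (\<exists>x y. pwpp_solution C x y \<and> G (code [enc_circuit C, code as]) = code [x, y]))))"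
proof -
  obtain F where F: "poly_time_computable F"
    "\<And>x res. yields reduce_act (initial Enter x) res \<Longrightarrow> F x = res"
    using reduction.poly_time[OF reduce_rank_initial] by blast
  obtain G where G: "poly_time_computable G"
    "\<And>x res. yields extract_act (initial Start x) res \<Longrightarrow> G x = res"
    using extraction.poly_time[OF extract_rank_initial] by blast
  have "\<exists>x y. pwpp_solution C x y \<and> G (code [enc_circuit C, code as]) = code [x, y]"
    if "pwpp_instance C" "ulc_solution (c_nin C) (output_bits C) as" for C as
    using last_two_collide[OF that] G(2)[OF extract_yields] by metis
  then show ?thesis
    using F G(1) ulc_instance_output_bits reduce_circuit by metis
qed

end
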